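(* Every Jordan net in $\mathbb{S}^n$ of type 1(a) is congruent to a diagonal net $\{\operatorname{Diag}(x{\bf 1}_{k_1},y{\bf 1}_{k_2},z{\bf 1}_{k_3})\mid x,y,z\in\mathbb{C}\}$ for some integers $k_1\ge k_2\ge k_3\ge1$ with $k_1+k_2+k_3=n$. Jordan nets in $\mathbb{S}^n$ of type 1(b) exist only for even $n$; they are congruent to the Kronecker product of ${\bf 1}_{n/2}$ with $\mathbb{S}^2$, i.e. to $\{{\bf 1}_{n/2}\otimes A\mid A\in\mathbb{S}^2\}$.
   Context: $\mathbb{S}^n$ is the space of symmetric $n\times n$ matrices over $\mathbb{C}$; ${\bf 1}_k$ is the $k\times k$ identity matrix. A Jordan net in $\mathbb{S}^n$ is a $3$-dimensional subspace $\mathcal{L}\subset\mathbb{S}^n$ containing an invertible matrix $U$ and closed under $X\bullet_UY=\frac12(XU^{-1}Y+YU^{-1}X)$. It has type 1(a) if $(\mathcal{L},\bullet_U)$ has a basis $U,X,Y$ with $X\bullet_U X=X$, $Y\bullet_U Y=Y$, $X\bullet_U Y=0$ (i.e. it is isomorphic to $\mathbb{C}\times\mathbb{C}\times\mathbb{C}$). It has type 1(b) if it has a basis $U,X,Y$ with $X\bullet_U X=Y\bullet_U Y=U$ and $X\bullet_U Y=0$ (i.e. it is isomorphic to the spin factor $\mathbb{C}\times\mathbb{C}^2$ with product $(\lambda,a)\bullet(\mu,b)=(\lambda\mu+a^\top b,\lambda b+\mu a)$). Subspaces $\mathcal{L},\mathcal{L}'$ are congruent if $\mathcal{L}'=P\mathcal{L}P^\top$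 for some $P\in{\rm GL}(n,\mathbb{C})$. *)

theory Defs
  imports Complex_Main "Jordan_Normal_Form.VS_Connect" "Jordan_Normal_Form.Gauss_Jordan_Elimination"
begin

text \<open>Complex matrices with their sizes as terms; inside \<open>module_mat TYPE(complex) n n\<close>, linear
  notions (subspace, dimension, basis) are those of the VectorSpace entry.\<close>

definition sym_mats :: "nat \<Rightarrow> complex mat set" where
  "sym_mats n = {A \<in> carrier_mat n n. transpose_mat A = A}"

definition mat_subspace :: "nat \<Rightarrow> complex mat set \<Rightarrow> bool" where
  "mat_subspace n L \<longleftrightarrow> VectorSpace.subspace class_ring L (module_mat TYPE(complex) n n)"

abbreviation mat_space_on :: "nat \<Rightarrow> complex mat set \<Rightarrow> (complex, complex mat) module" where
  "mat_space_on n L \<equiv> (module_mat TYPE(complex) n n)\<lparr>carrier := L\<rparr>"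

text \<open>\<open>mat_inverse U\<close> is \<open>Some\<close> of the two-sided inverse whenever \<open>U\<close> is invertible, the only
  case in which the product is used.\<close>

definition jordan_prod :: "complex mat \<Rightarrow> complex mat \<Rightarrow> complex mat \<Rightarrow> complex mat" where
  "jordan_prod U X Y =
     (let V = the (mat_inverse U) in (1/2) \<cdot>\<^sub>m (X * V * Y + Y * V * X))"

definition jordan_net_wrt :: "nat \<Rightarrow> complex mat set \<Rightarrow> complex mat \<Rightarrow> bool" where
  "jordan_net_wrt n L U \<longleftrightarrow>
     L \<subseteq> sym_mats n \<and> mat_subspace n L \<and>
     vectorspace.dim class_ring (mat_space_on n L) = 3 \<and>
     U \<in> L \<and> invertible_mat U \<and>
     (\<forall>X\<in>L. \<forall>Y\<in>L. jordan_prod U X Y \<in> L)"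

text \<open>In both types the unit \<open>U\<close> is existentially quantified. Since \<open>L\<close> has dimension 3,
  \<open>{U, X, Y}\<close> being a basis forces \<open>U\<close>, \<open>X\<close>, \<open>Y\<close> to be distinct.\<close>

definition jordan_net_type_1a :: "nat \<Rightarrow> complex mat set \<Rightarrow> bool" where
  "jordan_net_type_1a n L \<longleftrightarrow>
     (\<exists>U X Y. jordan_net_wrt n L U \<and>
        vectorspace.basis class_ring (mat_space_on n L) {U, X, Y} \<and>
        jordan_prod U X X = X \<and> jordan_prod U Y Y = Y \<and> jordan_prod U X Y = 0\<^sub>m n n)"

definition jordan_net_type_1b :: "nat \<Rightarrow> complex mat set \<Rightarrow> bool" where
  "jordan_net_type_1b n L \<longleftrightarrow>
     (\<exists>U X Y. jordan_net_wrt n L U \<and>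
        vectorspace.basis class_ring (mat_space_on n L) {U, X, Y} \<and>
        jordan_prod U X X = U \<and> jordan_prod U Y Y = U \<and> jordan_prod U X Y = 0\<^sub>m n n)"

definition congruent_mats :: "nat \<Rightarrow> complex mat set \<Rightarrow> complex mat set \<Rightarrow> bool" where
  "congruent_mats n L L' \<longleftrightarrow>
     (\<exists>P \<in> carrier_mat n n. invertible_mat P \<and> L' = (\<lambda>X. P * X * transpose_mat P) ` L)"

definition diag_net :: "nat \<Rightarrow> nat \<Rightarrow> nat \<Rightarrow> complex mat set" where
  "diag_net k1 k2 k3 =
     {diag_block_mat [x \<cdot>\<^sub>m 1\<^sub>m k1, y \<cdot>\<^sub>m 1\<^sub>m k2, z \<cdot>\<^sub>m 1\<^sub>m k3] | x y z. True}"

definition kronecker_prod :: "complex mat \<Rightarrow> complex mat \<Rightarrow> complex mat" where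
  "kronecker_prod A B =
     mat (dim_row A * dim_row B) (dim_col A * dim_col B)
       (\<lambda>(i, j). A $$ (i div dim_row B, j div dim_col B) * B $$ (i mod dim_row B, j mod dim_col B))"

end

theory Submission
  imports Defs
begin

text \<open>
  Let \<open>V\<close> be the inverse of the unit \<open>U\<close> and regard it as a nondegenerate symmetric bilinear form
  on column vectors. The map \<open>A \<mapsto> A V\<close> turns the product of the net into the symmetrized
  matrix product and symmetric matrices into \<open>V\<close>-self-adjoint operators, so an idempotent \<open>E\<close>
  of the net gives a \<open>V\<close>-orthogonal projection \<open>E V\<close>. Over the complex numbers the image of
  this projection has a \<open>V\<close>-orthonormal basis; with these vectors as the columns of \<open>B\<close> this says
  \<open>B\<^sup>T V B = 1\<close> and \<open>B B\<^sup>T = E\<close> (lemma \<open>idempotent_frame\<close>). Taking traces of \<open>E V\<close> counts the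
  columns. If mutually orthogonal idempotents add up to \<open>U\<close>, then the counts add up to \<open>n\<close>, and
  their bases together are the columns of a square \<open>Q\<close> with \<open>Q\<^sup>T V Q = 1\<close>. Congruence by
  \<open>P = Q\<^sup>T V\<close> then sends each \<open>A\<close> to the matrix of the operator \<open>A V\<close> in the basis \<open>Q\<close>
  (lemma \<open>congruent_span3\<close>), so only these operator matrices have to be found.

  In type 1(a), \<open>X\<close>, \<open>Y\<close> and \<open>U - X - Y\<close> are nonzero orthogonal idempotents spanning the net,
  because an element whose symmetrized product with an idempotent vanishes has product zero with it
  (lemma \<open>orthogonal_if_anticommutes_with_idempotent\<close>). In the joint basis they act as
  the three block projections; listing the blocks by size gives the diagonal net.

  In type 1(b), \<open>X V\<close> and \<open>Y V\<close> are anticommuting involutions. The eigenprojections of \<open>X V\<close> belong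
  to the orthogonal idempotents \<open>E = (U + X)/2\<close> and \<open>F = (U - X)/2\<close>, and \<open>Y V\<close> is an isometry
  exchanging their images. Both images therefore have the same dimension \<open>k\<close> and \<open>n = 2 k\<close>. If \<open>B\<close>
  is an orthonormal basis of the image of \<open>E V\<close> and \<open>C = Y V B\<close>, then in the basis that alternates
  between the columns of \<open>B\<close> and of \<open>C\<close>, the operators \<open>U V\<close>, \<open>X V\<close>, \<open>Y V\<close> are \<open>k\<close> copies of the
  \<open>2 \<times> 2\<close> matrices identity, \<open>Diag(1,-1)\<close> and the swap, which span the symmetric matrices
  (lemma \<open>involutions_congruent\<close>).
\<close>

section \<open>Matrix preliminaries\<close>

text \<open>Associativity with dimension side conditions, which the simplifier can discharge without guessing
  the sizes that occur in carrier sets.\<close>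

lemma mult_mat_assoc_dim:
  assumes "dim_col A = dim_row B" "dim_col B = dim_row C"
  shows "(A * B) * C = A * (B * (C :: 'a :: semiring_0 mat))"
  using assms by (intro assoc_mult_mat) auto

text \<open>Products are kept nested to the right; this applies an equation for a triple product at the head of a
  longer product.\<close>

lemma mult_mat_absorb:
  assumes "A * (B * C) = D" "dim_col A = dim_row B" "dim_col B = dim_row C" "dim_col C = dim_row Z"
  shows "A * (B * (C * Z)) = D * (Z :: 'a :: semiring_0 mat)"
proof -
  have "D * Z = (A * (B * C)) * Z" using assms(1) by simp
  also have "\<dots> = A * (B * (C * Z))" using assms(2-) by (simp add: mult_mat_assoc_dim)
  finally show ?thesis by simp
qed

lemma trace_mult_comm:
  fixes A B :: "'a :: comm_semiring_0 mat"
  assumes "A \<in> carrier_mat n k" "B \<in> carrier_mat k n"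
  shows "(\<Sum>i<n. (A * B) $$ (i, i)) = (\<Sum>j<k. (B * A) $$ (j, j))"
proof -
  have "(\<Sum>i<n. (A * B) $$ (i, i)) = (\<Sum>i<n. \<Sum>j<k. A $$ (i, j) * B $$ (j, i))"
    using assms by (intro sum.cong) (auto simp: scalar_prod_def atLeast0LessThan)
  also have "\<dots> = (\<Sum>j<k. \<Sum>i<n. B $$ (j, i) * A $$ (i, j))"
    by (subst sum.swap) (simp add: mult.commute)
  also have "\<dots> = (\<Sum>j<k. (B * A) $$ (j, j))"
    using assms by (intro sum.cong) (auto simp: scalar_prod_def atLeast0LessThan)
  finally show ?thesis .
qed

text \<open>Padding both factors with zeros to size \<open>k\<close> would otherwise give square matrices that are inverse
  to each other although the last row of one of them vanishes.\<close>

lemma left_inverse_imp_le: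
  fixes A B :: "'a :: field mat"
  assumes A: "A \<in> carrier_mat k n" and B: "B \<in> carrier_mat n k" and AB: "A * B = 1\<^sub>m k"
  shows "k \<le> n"
proof (rule ccontr)
  assume "\<not> k \<le> n"
  hence nk: "n < k" by simp
  \<comment> \<open>index \<open>n\<close> exists in the padded matrices because \<open>n < k\<close>\<close>
  define A' where "A' = mat k k (\<lambda>(i, j). if j < n then A $$ (i, j) else 0)"
  define B' where "B' = mat k k (\<lambda>(i, j). if i < n then B $$ (i, j) else 0)"
  have car: "A' \<in> carrier_mat k k" "B' \<in> carrier_mat k k" by (auto simp: A'_def B'_def)
  have "A' * B' = A * B"
  proof (rule eq_matI)
    fix i j assume "i < dim_row (A * B)" "j < dim_col (A * B)"
    hence ij: "i < k" "j < k" using A B by auto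
    have "(A' * B') $$ (i, j) = (\<Sum>l<k. (if l < n then A $$ (i, l) * B $$ (l, j) else 0))"
      using ij by (auto simp: A'_def B'_def scalar_prod_def atLeast0LessThan intro!: sum.cong)
    also have "\<dots> = (\<Sum>l<n. A $$ (i, l) * B $$ (l, j))"
      using nk by (intro sum.mono_neutral_cong_right) auto
    also have "\<dots> = (A * B) $$ (i, j)"
      using ij A B by (auto simp: scalar_prod_def atLeast0LessThan)
    finally show "(A' * B') $$ (i, j) = (A * B) $$ (i, j)" .
  qed (use A B in \<open>auto simp: A'_def B'_def\<close>)
  hence "B' * A' = 1\<^sub>m k" using AB car mat_mult_left_right_inverse by metis
  hence "(B' * A') $$ (n, n) = 1" using nk by simp
  moreover have "(B' * A') $$ (n, n) = 0"
    using nk by (simp add: A'_def B'_def scalar_prod_def)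
  ultimately show False by simp
qed

lemma adjoint_scalar_prod:
  fixes A :: "'a :: comm_semiring_0 mat"
  assumes "A \<in> carrier_mat n k" "x \<in> carrier_vec k" "y \<in> carrier_vec n"
  shows "(A *\<^sub>v x) \<bullet> y = x \<bullet> (transpose_mat A *\<^sub>v y)"
  using transpose_vec_mult_scalar[of A n k x y] assms
  by (metis comm_scalar_prod mult_mat_vec_carrier transpose_carrier_mat)

lemma gram_index:
  fixes A :: "'a :: comm_semiring_0 mat"
  assumes "A \<in> carrier_mat n n" "B \<in> carrier_mat n k" "C \<in> carrier_mat n l" "i < k" "j < l"
  shows "(transpose_mat B * (A * C)) $$ (i, j) = col B i \<bullet> (A *\<^sub>v col C j)"
  using assms by (simp add: col_mult2[of A n n C l] del: col_mult)

text \<open>Polarization: the value at \<open>e\<^sub>i + e\<^sub>j\<close> minus those at \<open>e\<^sub>i\<close> and \<open>e\<^sub>j\<close> is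
  \<open>2 A\<^sub>i\<^sub>j\<close>, so a form vanishing on all vectors is zero.\<close>

lemma symmetric_form_nonzero:
  fixes A :: "complex mat"
  assumes A: "A \<in> carrier_mat n n" and sym: "transpose_mat A = A" and nz: "A \<noteq> 0\<^sub>m n n"
  obtains v where "v \<in> carrier_vec n" "v \<bullet> (A *\<^sub>v v) \<noteq> 0"
proof -
  obtain i j where ij: "i < n" "j < n" "A $$ (i, j) \<noteq> 0"
    using nz A by (metis carrier_matD eq_matI index_zero_mat)
  have ent: "unit_vec n r \<bullet> (A *\<^sub>v unit_vec n s) = A $$ (r, s)" if "r < n" "s < n" for r s
    using that A by simp
  have ji: "A $$ (j, i) = A $$ (i, j)"
    using ij A sym by (metis carrier_matD index_transpose_mat(1))
  let ?v = "unit_vec n i + unit_vec n j"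
  have "?v \<bullet> (A *\<^sub>v ?v) = A $$ (i, i) + 2 * A $$ (i, j) + A $$ (j, j)"
    using ij A by (simp add: mult_add_distrib_mat_vec[of A n n] scalar_prod_add_distrib[of _ n]
        add_scalar_prod_distrib[of _ n] ent ji)
  hence "?v \<bullet> (A *\<^sub>v ?v) \<noteq> 0 \<or> unit_vec n i \<bullet> (A *\<^sub>v unit_vec n i) \<noteq> 0 \<or>
      unit_vec n j \<bullet> (A *\<^sub>v unit_vec n j) \<noteq> 0"
    using ij ent by auto
  thus ?thesis using that by (metis add_carrier_vec unit_vec_carrier)
qed

section \<open>Three-dimensional matrix spaces\<close>

definition span3 :: "complex mat \<Rightarrow> complex mat \<Rightarrow> complex mat \<Rightarrow> complex mat set" where
  "span3 A B C = {a \<cdot>\<^sub>m A + b \<cdot>\<^sub>m B + c \<cdot>\<^sub>m C | a b c. True}"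

text \<open>Since the dimension is three, the listed basis elements are distinct, so that a
  linear combination over the set \<open>{U, X, Y}\<close> has three independent coefficients.\<close>

lemma span_basis3:
  assumes sub: "mat_subspace n L" and dim: "vectorspace.dim class_ring (mat_space_on n L) = 3"
    and bas: "vectorspace.basis class_ring (mat_space_on n L) {U, X, Y}"
  shows "L = span3 U X Y" (is ?g1)
    and "a \<cdot>\<^sub>m U + b \<cdot>\<^sub>m X + c \<cdot>\<^sub>m Y = 0\<^sub>m n n \<Longrightarrow> a = 0 \<and> b = 0 \<and> c = 0"
    and "{U, X, Y} \<subseteq> L"
proof -
  interpret M: vectorspace class_ring "module_mat TYPE(complex) n n" by (rule matrix_vs)
  have sb: "VectorSpace.subspace class_ring L (module_mat TYPE(complex) n n)"
    using sub by (simp add: mat_subspace_def)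
  interpret W: vectorspace class_ring "mat_space_on n L" by (rule M.subspace_is_vs[OF sb])
  have UL: "{U, X, Y} \<subseteq> L" and gen: "W.span {U, X, Y} = L" and ind: "W.lin_indpt {U, X, Y}"
    using bas by (auto simp: W.basis_def)
  have "card {U, X, Y} = 3" using W.dim_basis[OF _ bas] dim by simp
  hence dist: "U \<noteq> X" "U \<noteq> Y" "X \<noteq> Y" by (auto simp: card_insert_if split: if_splits)
  have LC: "L \<subseteq> carrier_mat n n"
    using submodule.subset[OF M.is_module[OF sb]] by (simp add: module_mat_simps)
  have lc: "W.lincomb f {U, X, Y} = f U \<cdot>\<^sub>m U + f X \<cdot>\<^sub>m X + f Y \<cdot>\<^sub>m Y" for f
  proof -
    have "W.lincomb f {U, X, Y} = M.lincomb f {U, X, Y}"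
      by (rule M.lincomb_not_depend[symmetric]) (use UL sb in auto)
    also have "\<dots> = f U \<cdot>\<^sub>m U + (f X \<cdot>\<^sub>m X + f Y \<cdot>\<^sub>m Y)"
    proof -
      have c: "U \<in> carrier_mat n n" "X \<in> carrier_mat n n" "Y \<in> carrier_mat n n"
        using UL LC by auto
      show ?thesis
        unfolding M.lincomb_def using c dist
        by (simp add: M.M.finsum_insert module_mat_simps Pi_iff)
    qed
    also have "\<dots> = f U \<cdot>\<^sub>m U + f X \<cdot>\<^sub>m X + f Y \<cdot>\<^sub>m Y"
      using UL LC by (subst assoc_add_mat[of _ n n]) auto
    finally show ?thesis .
  qed
  have coeffs: "\<exists>f. f U = a \<and> f X = b \<and> f Y = c" for a b c :: complex
    by (rule exI[of _ "\<lambda>Z. if Z = U then a else if Z = X then b else c"]) (use dist in auto)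
  have "L = {W.lincomb f {U, X, Y} | f. f \<in> {U, X, Y} \<rightarrow> carrier class_ring}"
    using W.finite_span[of "{U, X, Y}"] UL gen by simp
  thus ?g1 unfolding lc span3_def using coeffs by (auto simp: set_eq_iff) metis+
  show "a = 0 \<and> b = 0 \<and> c = 0" if eq: "a \<cdot>\<^sub>m U + b \<cdot>\<^sub>m X + c \<cdot>\<^sub>m Y = 0\<^sub>m n n"
  proof -
    obtain f where f: "f U = a" "f X = b" "f Y = c" using coeffs by blast
    have "W.lincomb f {U, X, Y} = \<zero>\<^bsub>mat_space_on n L\<^esub>"
      using eq f by (simp add: lc module_mat_simps)
    hence "\<forall>v\<in>{U, X, Y}. f v = 0"
      using ind unfolding W.lin_dep_def by (auto simp: class_ring_simps)
    thus ?thesis using f by simp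
  qed
  show "{U, X, Y} \<subseteq> L" by (rule UL)
qed

section \<open>Orthonormal factorizations of idempotents\<close>

lemma eq_of_minus_zero:
  fixes A B :: "complex mat"
  assumes "A - B = 0\<^sub>m n n" "A \<in> carrier_mat n n" "B \<in> carrier_mat n n"
  shows "B = A"
proof (rule eq_matI)
  fix i j assume "i < dim_row A" "j < dim_col A"
  thus "B $$ (i, j) = A $$ (i, j)"
    using arg_cong[OF assms(1), of "\<lambda>M. M $$ (i, j)"] assms(2,3) by simp
qed (use assms in auto)

text \<open>The columns of \<open>B\<close> are a \<open>V\<close>-orthonormal basis of the image of the projection \<open>E V\<close>.\<close>

definition frame :: "nat \<Rightarrow> complex mat \<Rightarrow> complex mat \<Rightarrow> nat \<Rightarrow> complex mat \<Rightarrow> bool" where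
  "frame n V E k B \<longleftrightarrow>
     B \<in> carrier_mat n k \<and> transpose_mat B * (V * B) = 1\<^sub>m k \<and> B * transpose_mat B = E"

text \<open>One Gram-Schmidt step inside the fixed space of \<open>E V\<close>.\<close>

lemma orthonormal_extend:
  fixes V E B :: "complex mat"
  assumes V: "V \<in> carrier_mat n n" "transpose_mat V = V" and E: "E \<in> carrier_mat n n"
    and B: "B \<in> carrier_mat n k" "transpose_mat B * (V * B) = 1\<^sub>m k" "E * (V * B) = B"
    and w: "w \<in> carrier_vec n" "transpose_mat B *\<^sub>v (V *\<^sub>v w) = 0\<^sub>v k" "w \<bullet> (V *\<^sub>v w) = 1"
      "E *\<^sub>v (V *\<^sub>v w) = w"
  obtains B' where "B' \<in> carrier_mat n (Suc k)" "transpose_mat B' * (V * B') = 1\<^sub>m (Suc k)"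
    "E * (V * B') = B'"
proof
  define B' where "B' = mat_of_cols n (cols B @ [w])"
  have set: "set (cols B @ [w]) \<subseteq> carrier_vec n"
    using B(1) w(1) cols_dim[of B] by auto
  show B': "B' \<in> carrier_mat n (Suc k)" using B(1) by (auto simp: B'_def)
  have col: "col B' j = (if j < k then col B j else w)" if "j < Suc k" for j
    using that B(1) w(1) by (auto simp: B'_def nth_append cols_length)
  have perp: "col B i \<bullet> (V *\<^sub>v w) = 0" if "i < k" for i
  proof -
    have "(transpose_mat B *\<^sub>v (V *\<^sub>v w)) $ i = 0" using w(2) that by simp
    thus ?thesis using that B(1) by simp
  qed
  have perp': "w \<bullet> (V *\<^sub>v col B i) = 0" if "i < k" for i
    using perp[OF that] adjoint_scalar_prod[OF V(1), of "w" "col B i"] V B(1) w(1) that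
    by (metis col_carrier_vec comm_scalar_prod carrier_matD(2) carrier_matI mult_mat_vec_carrier carrier_matD(1))
  have gram: "col B i \<bullet> (V *\<^sub>v col B j) = (if i = j then 1 else 0)" if "i < k" "j < k" for i j
    using gram_index[OF V(1) B(1,1) that] B(2) that by simp
  show "transpose_mat B' * (V * B') = 1\<^sub>m (Suc k)"
  proof (rule eq_matI)
    fix i j assume "i < dim_row (1\<^sub>m (Suc k) :: complex mat)" "j < dim_col (1\<^sub>m (Suc k) :: complex mat)"
    hence ij: "i < Suc k" "j < Suc k" by auto
    show "(transpose_mat B' * (V * B')) $$ (i, j) = 1\<^sub>m (Suc k) $$ (i, j)"
      unfolding gram_index[OF V(1) B' B' ij] col[OF ij(1)] col[OF ij(2)]
      using ij w(3) by (auto simp: gram perp perp')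
  qed (use B' V in auto)
  show "E * (V * B') = B'"
  proof (rule mat_col_eqI)
    fix j assume "j < dim_col B'"
    hence j: "j < Suc k" using B' by simp
    have c: "col B' j \<in> carrier_vec n" using j B(1) w(1) by (auto simp: col)
    have old: "E *\<^sub>v (V *\<^sub>v col B j) = col B j" if "j < k"
    proof -
      have "col B j = col (E * (V * B)) j" using B(3) by simp
      also have "\<dots> = E *\<^sub>v (V *\<^sub>v col B j)"
        using that B(1) V(1) E by (simp add: col_mult2[of _ n n _ k] del: col_mult)
      finally show ?thesis by simp
    qed
    have "col (E * (V * B')) j = E *\<^sub>v (V *\<^sub>v col B' j)"
      using j B' V(1) E by (simp add: col_mult2[of _ n n _ "Suc k"] del: col_mult)
    also have "\<dots> = col B' j" using j w(4) by (auto simp: col old)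
    finally show "col (E * (V * B')) j = col B' j" .
  qed (use B' E in auto)
qed

text \<open>Take a \<open>V\<close>-orthonormal family \<open>B\<close> in the fixed space of \<open>E V\<close> with as many columns as possible.
  Then \<open>F = E - B B\<^sup>T\<close> is again idempotent, and \<open>F V\<close> projects onto the orthogonal complement of the columns
  of \<open>B\<close> in that space. If \<open>F\<close> were nonzero, it would have a vector \<open>v\<close> with \<open>v\<^sup>T F v \<noteq> 0\<close>; as
  \<open>F V F = F\<close>, this number is the \<open>V\<close>-square of \<open>F v\<close>, so \<open>F v\<close> can be normalized and added to the family.\<close>

lemma idempotent_frame:
  fixes V E :: "complex mat"
  assumes V: "V \<in> carrier_mat n n" "transpose_mat V = V"
    and E: "E \<in> carrier_mat n n" "transpose_mat E = E" "E * (V * E) = E"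
  obtains k B where "frame n V E k B"
proof -
  define S where "S = {k. \<exists>B \<in> carrier_mat n k. transpose_mat B * (V * B) = 1\<^sub>m k \<and> E * (V * B) = B}"
  have bound: "k \<le> n" if "k \<in> S" for k
    using that left_inverse_imp_le V unfolding S_def
    by (smt (verit, best) mem_Collect_eq mult_carrier_mat transpose_carrier_mat)
  hence fin: "finite S" by (meson finite_nat_set_iff_bounded_le)
  have "0 \<in> S" unfolding S_def
    by (auto intro!: bexI[of _ "0\<^sub>m n 0"] eq_matI) (use V E in auto)
  hence "Max S \<in> S" using fin Max_in by blast
  then obtain k B where k: "k = Max S" and B: "B \<in> carrier_mat n k"
    "transpose_mat B * (V * B) = 1\<^sub>m k" "E * (V * B) = B"
    unfolding S_def by blast
  define F where "F = E - B * transpose_mat B"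
  note [simp] = carrier_matD[OF V(1)] carrier_matD[OF E(1)] carrier_matD[OF B(1)]
  have BB: "B * transpose_mat B \<in> carrier_mat n n" using B(1) by simp
  have F1: "F \<in> carrier_mat n n" unfolding F_def by (rule minus_carrier_mat[OF BB])
  have F2: "transpose_mat F = F"
    unfolding F_def using transpose_minus[OF E(1) BB] transpose_mult[OF B(1), of "transpose_mat B" n] B(1) E(2)
    by simp
  note F = F1 F2
  have VB: "V * B \<in> carrier_mat n k" "V * E \<in> carrier_mat n n" "V * (B * transpose_mat B) \<in> carrier_mat n n"
     "transpose_mat B \<in> carrier_mat k n"
    using V(1) E(1) B(1) BB by simp_all
  have BVE: "transpose_mat B * (V * E) = transpose_mat B"
  proof -
    have "transpose_mat B = transpose_mat (E * (V * B))" using B(3) by simp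
    also have "\<dots> = transpose_mat B * V * E"
      by (simp only: transpose_mult[OF E(1) VB(1)] transpose_mult[OF V(1) B(1)] V(2) E(2))
    finally show ?thesis by (simp add: mult_mat_assoc_dim)
  qed
  have VF: "V * F = V * E - V * (B * transpose_mat B)"
    unfolding F_def by (rule mult_minus_distrib_mat[OF V(1) E(1) BB])
  have BVF: "transpose_mat B * (V * F) = 0\<^sub>m k n"
    unfolding VF mult_minus_distrib_mat[OF VB(4,2,3)] BVE
    using VB(4) by (simp add: mult_mat_absorb[OF B(2)])
  have "E * (V * F) = E - B * transpose_mat B"
    unfolding VF mult_minus_distrib_mat[OF E(1) VB(2,3)] E(3)
    by (simp add: mult_mat_absorb[OF B(3)])
  hence EVF: "E * (V * F) = F" by (simp only: F_def[symmetric])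
  have FVF: "F * (V * F) = F"
  proof -
    have "F * (V * F) = E * (V * F) - B * transpose_mat B * (V * F)"
      using minus_mult_distrib_mat[OF E(1) BB, of "V * F" n] V(1) F1 by (simp only: F_def[symmetric] mult_carrier_mat)
    also have "B * transpose_mat B * (V * F) = 0\<^sub>m n n"
      using B(1) F1 BVF by (simp add: mult_mat_assoc_dim)
    finally have "F * (V * F) = F - 0\<^sub>m n n" by (simp only: EVF)
    thus ?thesis using F1 by auto
  qed
  have "F = 0\<^sub>m n n"
  proof (rule ccontr)
    assume "F \<noteq> 0\<^sub>m n n"
    then obtain v where v: "v \<in> carrier_vec n" "v \<bullet> (F *\<^sub>v v) \<noteq> 0"
      using symmetric_form_nonzero F by blast
    \<comment> \<open>scaling \<open>v\<close> by \<open>c\<close> multiplies its \<open>F\<close>-square by \<open>c\<^sup>2\<close> and thus makes it \<open>1\<close>\<close>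
    define c where "c = 1 / csqrt (v \<bullet> (F *\<^sub>v v))"
    have cc: "c * (c * (v \<bullet> (F *\<^sub>v v))) = 1"
      using v(2) by (simp add: c_def field_simps flip: power2_eq_square)
    define u where "u = c \<cdot>\<^sub>v v"
    define w where "w = F *\<^sub>v u"
    have u: "u \<in> carrier_vec n" using v by (simp add: u_def)
    have w: "w \<in> carrier_vec n" using u F by (simp add: w_def)
    have VFc: "V * F \<in> carrier_mat n n" using V F by simp
    have Vw: "V *\<^sub>v w = (V * F) *\<^sub>v u" using V F u by (simp add: w_def)
    have 1: "transpose_mat B *\<^sub>v (V *\<^sub>v w) = 0\<^sub>v k"
    proof -
      have "transpose_mat B *\<^sub>v (V *\<^sub>v w) = (transpose_mat B * (V * F)) *\<^sub>v u"
        unfolding Vw using B(1) VFc u by (intro assoc_mult_mat_vec[symmetric]) auto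
      thus ?thesis using u BVF by auto
    qed
    have 2: "A *\<^sub>v (V *\<^sub>v w) = w" if "A \<in> carrier_mat n n" "A * (V * F) = F" for A
    proof -
      have "A *\<^sub>v (V *\<^sub>v w) = (A * (V * F)) *\<^sub>v u"
        unfolding Vw using that VFc u by (intro assoc_mult_mat_vec[symmetric]) auto
      thus ?thesis using that by (simp add: w_def)
    qed
    have "w \<bullet> (V *\<^sub>v w) = u \<bullet> (F *\<^sub>v (V *\<^sub>v w))"
      unfolding w_def using adjoint_scalar_prod[OF F(1) u, of "V *\<^sub>v (F *\<^sub>v u)"] F u V by simp
    also have "\<dots> = u \<bullet> (F *\<^sub>v u)" using 2[OF F(1) FVF] by (simp add: w_def)
    also have "\<dots> = 1"
      using v(1) F(1) cc by (simp add: u_def mult_mat_vec[of F n n])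
    finally have 3: "w \<bullet> (V *\<^sub>v w) = 1" .
    obtain B' where "B' \<in> carrier_mat n (Suc k)" "transpose_mat B' * (V * B') = 1\<^sub>m (Suc k)"
      "E * (V * B') = B'"
      using orthonormal_extend[OF V E(1) B w 1 3 2[OF E(1) EVF]] by blast
    hence "Suc k \<in> S" unfolding S_def by blast
    thus False using Max_ge[OF fin] k by fastforce
  qed
  hence "B * transpose_mat B = E" unfolding F_def using E(1) BB
    by (rule_tac eq_of_minus_zero) auto
  thus ?thesis using that B unfolding frame_def by blast
qed

text \<open>The last equation is the invariance of the trace under exchanging factors:
  \<open>tr (B B\<^sup>T V) = tr (B\<^sup>T V B)\<close>. The number of columns is thus additive in \<open>E\<close>.\<close>

lemma frame_facts:
  assumes V: "V \<in> carrier_mat n n" "transpose_mat V = V" and fr: "frame n V E k B"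
  shows "E \<in> carrier_mat n n" "transpose_mat E = E" "E * (V * B) = B"
    "transpose_mat B * (V * E) = transpose_mat B" "(\<Sum>i<n. (E * V) $$ (i, i)) = of_nat k"
proof -
  have B: "B \<in> carrier_mat n k" "transpose_mat B * (V * B) = 1\<^sub>m k" "E = B * transpose_mat B"
    using fr by (auto simp: frame_def)
  note [simp] = carrier_matD[OF V(1)] carrier_matD[OF B(1)]
  show "E \<in> carrier_mat n n" "transpose_mat E = E"
    using B by (auto simp: transpose_mult[of _ n k])
  show "E * (V * B) = B" using B by (simp add: mult_mat_assoc_dim)
  show "transpose_mat B * (V * E) = transpose_mat B"
    using B V by (simp add: mult_mat_absorb[OF B(2)])
  have "(\<Sum>i<n. (E * V) $$ (i, i)) = (\<Sum>i<n. (B * (transpose_mat B * V)) $$ (i, i))"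
    using B by (simp add: mult_mat_assoc_dim)
  also have "\<dots> = (\<Sum>j<k. (transpose_mat B * V * B) $$ (j, j))"
    using B V by (intro trace_mult_comm) auto
  also have "\<dots> = of_nat k" using B by (simp add: mult_mat_assoc_dim)
  finally show "(\<Sum>i<n. (E * V) $$ (i, i)) = of_nat k" .
qed

text \<open>Insert \<open>E V\<close> next to \<open>B\<close> and \<open>F V\<close> next to \<open>C\<close>, which changes neither.\<close>

lemma frames_orthogonal:
  assumes V: "V \<in> carrier_mat n n" "transpose_mat V = V"
    and B: "frame n V E k B" and C: "frame n V F l C" and EF: "E * (V * F) = 0\<^sub>m n n"
  shows "transpose_mat B * (V * C) = 0\<^sub>m k l"
proof -
  note f = frame_facts[OF V B] and g = frame_facts[OF V C]
  have c: "B \<in> carrier_mat n k" "C \<in> carrier_mat n l" using B C by (auto simp: frame_def)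
  note [simp] = carrier_matD[OF V(1)] carrier_matD[OF f(1)] carrier_matD[OF g(1)]
    carrier_matD[OF c(1)] carrier_matD[OF c(2)]
  have "transpose_mat B * (V * C) = transpose_mat B * (V * (E * (V * (F * (V * C)))))"
    by (simp add: g(3) mult_mat_absorb[OF f(4)])
  also have "E * (V * (F * (V * C))) = 0\<^sub>m n l"
    using c V by (simp add: mult_mat_absorb[OF EF])
  finally show ?thesis using c V by simp
qed

section \<open>Congruence from a common orthonormal basis\<close>

text \<open>With \<open>P = Q\<^sup>T V\<close> one has \<open>P\<^sup>T = V Q\<close> and \<open>P Q = 1\<close>, hence
  \<open>P A P\<^sup>T = P (A V Q) = P Q D = D\<close>.\<close>

lemma congruent_span3:
  fixes V Q :: "complex mat"
  assumes V: "V \<in> carrier_mat n n" "transpose_mat V = V"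
    and Q: "Q \<in> carrier_mat n n" "transpose_mat Q * (V * Q) = 1\<^sub>m n"
    and A: "A1 \<in> carrier_mat n n" "A2 \<in> carrier_mat n n" "A3 \<in> carrier_mat n n"
    and D: "D1 \<in> carrier_mat n n" "D2 \<in> carrier_mat n n" "D3 \<in> carrier_mat n n"
    and AD: "A1 * (V * Q) = Q * D1" "A2 * (V * Q) = Q * D2" "A3 * (V * Q) = Q * D3"
  shows "congruent_mats n (span3 A1 A2 A3) (span3 D1 D2 D3)"
proof -
  define P where "P = transpose_mat Q * V"
  have P: "P \<in> carrier_mat n n" using V Q by (simp add: P_def)
  have PT: "transpose_mat P = V * Q"
    using V Q by (simp add: P_def transpose_mult[of _ n n _ n])
  have PTc: "transpose_mat P \<in> carrier_mat n n" using P by simp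
  have PQ: "P * Q = 1\<^sub>m n"
    using V(1) Q by (simp add: P_def mult_mat_assoc_dim)
  hence QP: "Q * P = 1\<^sub>m n" using mat_mult_left_right_inverse P Q(1) by blast
  have inv: "invertible_mat P"
    unfolding invertible_mat_def inverts_mat_def using P Q(1) PQ QP
    by (auto intro!: exI[of _ Q])
  have diag: "P * M * transpose_mat P = D"
    if "M * (V * Q) = Q * D" "M \<in> carrier_mat n n" "D \<in> carrier_mat n n" for M D
  proof -
    have "P * M * transpose_mat P = P * (M * (V * Q))"
      unfolding PT using P that V Q by (intro assoc_mult_mat) auto
    also have "\<dots> = P * Q * D" unfolding that(1) using P Q that by simp
    finally show ?thesis using that PQ by simp
  qed
  have "P * (a \<cdot>\<^sub>m A1 + b \<cdot>\<^sub>m A2 + c \<cdot>\<^sub>m A3) * transpose_mat P =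
      a \<cdot>\<^sub>m D1 + b \<cdot>\<^sub>m D2 + c \<cdot>\<^sub>m D3" for a b c
  proof -
    have m: "P * (x \<cdot>\<^sub>m M) * transpose_mat P = x \<cdot>\<^sub>m (P * M * transpose_mat P)"
      if "M \<in> carrier_mat n n" for M x
      using that P PTc by (simp add: mult_smult_distrib[of _ n n _ n] mult_smult_assoc_mat[of _ n n _ n])
    have p: "P * (M + N) * transpose_mat P = P * M * transpose_mat P + P * N * transpose_mat P"
      if "M \<in> carrier_mat n n" "N \<in> carrier_mat n n" for M N
      using that P PTc by (simp add: mult_add_distrib_mat[of _ n n _ n] add_mult_distrib_mat[of _ n n _ _ n])
    show ?thesis using A D AD by (simp add: p m diag)
  qed
  hence "span3 D1 D2 D3 = (\<lambda>X. P * X * transpose_mat P) ` span3 A1 A2 A3"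
    unfolding span3_def by (force simp: image_iff)
  thus ?thesis unfolding congruent_mats_def using P inv by blast
qed

text \<open>All operators of interest send each basis vector to a multiple of a basis vector; the function \<open>s\<close>
  records which one and \<open>d\<close> the factor.\<close>

lemma monomial_intertwine:
  fixes A V Q :: "complex mat"
  assumes car: "A \<in> carrier_mat n n" "V \<in> carrier_mat n n" "Q \<in> carrier_mat n n"
    and s: "\<And>j. j < n \<Longrightarrow> s j < n"
    and col: "\<And>j. j < n \<Longrightarrow> A *\<^sub>v (V *\<^sub>v col Q j) = d j \<cdot>\<^sub>v col Q (s j)"
  shows "A * (V * Q) = Q * mat n n (\<lambda>(l, j). if l = s j then d j else 0)"
proof (rule eq_matI)
  let ?D = "mat n n (\<lambda>(l, j). if l = s j then d j else 0)"
  fix i j assume "i < dim_row (Q * ?D)" "j < dim_col (Q * ?D)"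
  hence ij: "i < n" "j < n" using car by auto
  have "(A * (V * Q)) $$ (i, j) = (A *\<^sub>v (V *\<^sub>v col Q j)) $ i"
    using ij car by (simp add: col_mult2[of V n n Q n] del: col_mult)
  also have "\<dots> = d j * Q $$ (i, s j)" using ij s car by (simp add: col)
  also have "\<dots> = (\<Sum>l<n. Q $$ (i, l) * (if l = s j then d j else 0))"
    using s ij by (simp add: if_distrib cong: if_cong)
  also have "\<dots> = (Q * ?D) $$ (i, j)"
    using ij car by (simp add: scalar_prod_def atLeast0LessThan)
  finally show "(A * (V * Q)) $$ (i, j) = (Q * ?D) $$ (i, j)" .
qed (use car in auto)

lemma col_of_mult_eq:
  fixes A V B :: "complex mat"
  assumes "A * (V * B) = Z" "A \<in> carrier_mat n n" "V \<in> carrier_mat n n" "B \<in> carrier_mat n k" "a < k"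
  shows "A *\<^sub>v (V *\<^sub>v col B a) = col Z a"
  using assms by (auto simp: col_mult2[of _ n n _ k] simp del: col_mult)

lemma orthonormal_columns:
  fixes V :: "complex mat"
  assumes V: "V \<in> carrier_mat n n" and q: "\<And>j. j < n \<Longrightarrow> q j \<in> carrier_vec n"
    and gram: "\<And>i j. i < n \<Longrightarrow> j < n \<Longrightarrow> q i \<bullet> (V *\<^sub>v q j) = (if i = j then 1 else 0)"
  obtains Q where "Q \<in> carrier_mat n n" "\<And>j. j < n \<Longrightarrow> col Q j = q j"
    "transpose_mat Q * (V * Q) = 1\<^sub>m n"
proof
  define Q where "Q = mat_of_cols n (map q [0..<n])"
  show Q: "Q \<in> carrier_mat n n" using mat_of_cols_carrier(1)[of n "map q [0..<n]"] by (simp add: Q_def)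
  show col: "col Q j = q j" if "j < n" for j using that q by (simp add: Q_def)
  show "transpose_mat Q * (V * Q) = 1\<^sub>m n"
  proof (rule eq_matI)
    fix i j assume "i < dim_row (1\<^sub>m n :: complex mat)" "j < dim_col (1\<^sub>m n :: complex mat)"
    hence ij: "i < n" "j < n" by auto
    show "(transpose_mat Q * (V * Q)) $$ (i, j) = 1\<^sub>m n $$ (i, j)"
      unfolding gram_index[OF V Q Q ij] using ij by (simp add: col gram)
  qed (use Q V in auto)
qed

lemma frame_gram:
  assumes V: "V \<in> carrier_mat n n" and B: "frame n V E k B" and ij: "i < k" "j < k"
  shows "col B i \<bullet> (V *\<^sub>v col B j) = (if i = j then 1 else 0)"
  by (subst gram_index[OF V _ _ ij, symmetric]) (use B ij in \<open>auto simp: frame_def\<close>)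

lemma frames_gram_0:
  assumes V: "V \<in> carrier_mat n n" "transpose_mat V = V"
    and B: "frame n V E k B" and C: "frame n V F l C" and EF: "E * (V * F) = 0\<^sub>m n n"
    and ij: "i < k" "j < l"
  shows "col B i \<bullet> (V *\<^sub>v col C j) = 0"
  by (subst gram_index[OF V(1) _ _ ij, symmetric])
    (use B C ij frames_orthogonal[OF V B C EF] in \<open>auto simp: frame_def\<close>)

text \<open>The columns of \<open>C\<close> are fixed by \<open>F V\<close>, which \<open>E V\<close> annihilates.\<close>

lemma frame_act_0:
  assumes V: "V \<in> carrier_mat n n" "transpose_mat V = V"
    and C: "frame n V F l C" and E: "E \<in> carrier_mat n n" "E * (V * F) = 0\<^sub>m n n"
  shows "E * (V * C) = 0\<^sub>m n l"
proof -
  have c: "C \<in> carrier_mat n l" using C by (simp add: frame_def)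
  note f = frame_facts[OF V C]
  note [simp] = carrier_matD[OF V(1)] carrier_matD[OF f(1)] carrier_matD[OF E(1)] carrier_matD[OF c]
  have "E * (V * C) = E * (V * (F * (V * C)))" by (simp add: f(3))
  also have "\<dots> = 0\<^sub>m n l" using c V(1) by (simp add: mult_mat_absorb[OF E(2)])
  finally show ?thesis .
qed

lemma orthogonal_sym:
  assumes V: "V \<in> carrier_mat n n" "transpose_mat V = V"
    and E: "E \<in> carrier_mat n n" "transpose_mat E = E"
    and F: "F \<in> carrier_mat n n" "transpose_mat F = F"
    and EF: "E * (V * F) = 0\<^sub>m n n"
  shows "F * (V * E) = (0\<^sub>m n n :: complex mat)"
proof -
  have "transpose_mat (E * (V * F)) = F * V * E"
    using V F E by (simp only: transpose_mult[of E n n "V * F" n] transpose_mult[of V n n F n] mult_carrier_mat)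
  thus ?thesis using EF V E F by simp
qed

lemma congruent_diag_net:
  assumes V: "V \<in> carrier_mat n n" "transpose_mat V = V"
    and B1: "frame n V E1 k1 B1" and B2: "frame n V E2 k2 B2" and B3: "frame n V E3 k3 B3"
    and orth: "E1 * (V * E2) = 0\<^sub>m n n" "E1 * (V * E3) = 0\<^sub>m n n" "E2 * (V * E3) = 0\<^sub>m n n"
    and n: "n = k1 + k2 + k3"
  shows "congruent_mats n (span3 E1 E2 E3) (diag_net k1 k2 k3)"
proof -
  note f1 = frame_facts[OF V B1] and f2 = frame_facts[OF V B2] and f3 = frame_facts[OF V B3]
  have orth': "E2 * (V * E1) = 0\<^sub>m n n" "E3 * (V * E1) = 0\<^sub>m n n" "E3 * (V * E2) = 0\<^sub>m n n"
    using orthogonal_sym[OF V f1(1,2) f2(1,2) orth(1)] orthogonal_sym[OF V f1(1,2) f3(1,2) orth(2)]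
      orthogonal_sym[OF V f2(1,2) f3(1,2) orth(3)] by auto
  have c: "B1 \<in> carrier_mat n k1" "B2 \<in> carrier_mat n k2" "B3 \<in> carrier_mat n k3"
    using B1 B2 B3 by (auto simp: frame_def)
  have less: "j < k1 + k2 + k3" if "j < n" for j using that n by simp
  define q where "q = (\<lambda>j. if j < k1 then col B1 j else if j < k1 + k2 then col B2 (j - k1)
     else col B3 (j - k1 - k2))"
  have q: "q j \<in> carrier_vec n" if "j < n" for j
    by (rule carrier_vecI) (simp add: q_def carrier_matD[OF c(1)] carrier_matD[OF c(2)] carrier_matD[OF c(3)])
  have gram: "q i \<bullet> (V *\<^sub>v q j) = (if i = j then 1 else 0)" if "i < n" "j < n" for i j
    using less[OF that(1)] less[OF that(2)] unfolding q_def
    by (auto simp: frame_gram[OF V(1) B1] frame_gram[OF V(1) B2] frame_gram[OF V(1) B3]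
        frames_gram_0[OF V B1 B2 orth(1)] frames_gram_0[OF V B1 B3 orth(2)] frames_gram_0[OF V B2 B3 orth(3)]
        frames_gram_0[OF V B2 B1 orth'(1)] frames_gram_0[OF V B3 B1 orth'(2)] frames_gram_0[OF V B3 B2 orth'(3)])
  obtain Q where Q: "Q \<in> carrier_mat n n" "\<And>j. j < n \<Longrightarrow> col Q j = q j"
    "transpose_mat Q * (V * Q) = 1\<^sub>m n"
    using orthonormal_columns[OF V(1) q gram] by blast
  define D where "D = (\<lambda>d. mat n n (\<lambda>(l, j). if l = j then d j else (0::complex)))"
  define d1 :: "nat \<Rightarrow> complex" where "d1 = (\<lambda>j. if j < k1 then 1 else 0)"
  define d2 :: "nat \<Rightarrow> complex" where "d2 = (\<lambda>j. if j < k1 then 0 else if j < k1 + k2 then 1 else 0)"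
  define d3 :: "nat \<Rightarrow> complex" where "d3 = (\<lambda>j. if j < k1 + k2 then 0 else 1)"
  have D: "D d \<in> carrier_mat n n" for d by (simp add: D_def)
  have zero: "A *\<^sub>v (V *\<^sub>v col C a) = 0\<^sub>v n"
    if "frame n V F l C" "A \<in> carrier_mat n n" "A * (V * F) = 0\<^sub>m n n" "a < l" for A C a F l
    using col_of_mult_eq[OF frame_act_0[OF V that(1-3)] that(2) V(1) _ that(4)] that
    by (simp add: frame_def)
  have smult0: "0 \<cdot>\<^sub>v v = 0\<^sub>v n" if "v \<in> carrier_vec n" for v :: "complex vec"
    using that by auto
  have 1: "E1 * (V * Q) = Q * D d1" unfolding D_def
  proof (rule monomial_intertwine[OF f1(1) V(1) Q(1)])
    fix j assume j: "j < n"
    show "E1 *\<^sub>v (V *\<^sub>v col Q j) = d1 j \<cdot>\<^sub>v col Q j"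
      using less[OF j] q[OF j] unfolding Q(2)[OF j] q_def d1_def
      by (auto simp: smult0 col_of_mult_eq[OF f1(3) f1(1) V(1) c(1)] zero[OF B2 f1(1) orth(1)] zero[OF B3 f1(1) orth(2)])
  qed
  have 2: "E2 * (V * Q) = Q * D d2" unfolding D_def
  proof (rule monomial_intertwine[OF f2(1) V(1) Q(1)])
    fix j assume j: "j < n"
    show "E2 *\<^sub>v (V *\<^sub>v col Q j) = d2 j \<cdot>\<^sub>v col Q j"
      using less[OF j] q[OF j] unfolding Q(2)[OF j] q_def d2_def
      by (auto simp: smult0 col_of_mult_eq[OF f2(3) f2(1) V(1) c(2)] zero[OF B1 f2(1) orth'(1)] zero[OF B3 f2(1) orth(3)])
  qed
  have 3: "E3 * (V * Q) = Q * D d3" unfolding D_def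
  proof (rule monomial_intertwine[OF f3(1) V(1) Q(1)])
    fix j assume j: "j < n"
    show "E3 *\<^sub>v (V *\<^sub>v col Q j) = d3 j \<cdot>\<^sub>v col Q j"
      using less[OF j] q[OF j] unfolding Q(2)[OF j] q_def d3_def
      by (auto simp: smult0 col_of_mult_eq[OF f3(3) f3(1) V(1) c(3)] zero[OF B1 f3(1) orth'(2)] zero[OF B2 f3(1) orth'(3)])
  qed
  have "x \<cdot>\<^sub>m D d1 + y \<cdot>\<^sub>m D d2 + z \<cdot>\<^sub>m D d3 =
      diag_block_mat [x \<cdot>\<^sub>m 1\<^sub>m k1, y \<cdot>\<^sub>m 1\<^sub>m k2, z \<cdot>\<^sub>m 1\<^sub>m k3]" for x y z
    by (rule eq_matI) (auto simp: D_def d1_def d2_def d3_def n Let_def)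
  hence "span3 (D d1) (D d2) (D d3) = diag_net k1 k2 k3"
    by (auto simp: span3_def diag_net_def)
  thus ?thesis
    using congruent_span3[OF V Q(1,3) f1(1) f2(1) f3(1) D D D 1 2 3] by simp
qed

section \<open>Orthogonal idempotents and diagonal nets\<close>

text \<open>Used to order the idempotents by decreasing rank.\<close>

lemma span3_perm:
  assumes "A \<in> carrier_mat n n" "B \<in> carrier_mat n n" "C \<in> carrier_mat n n"
  shows "span3 A B C = span3 B A C" "span3 A B C = span3 A C B"
proof -
  have 1: "a \<cdot>\<^sub>m A + b \<cdot>\<^sub>m B + c \<cdot>\<^sub>m C = b \<cdot>\<^sub>m B + a \<cdot>\<^sub>m A + c \<cdot>\<^sub>m C" for a b c
    using assms by (intro eq_matI) auto
  have 2: "a \<cdot>\<^sub>m A + b \<cdot>\<^sub>m B + c \<cdot>\<^sub>m C = a \<cdot>\<^sub>m A + c \<cdot>\<^sub>m C + b \<cdot>\<^sub>m B" for a b c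
    using assms by (intro eq_matI) auto
  show "span3 A B C = span3 B A C" unfolding span3_def by (subst 1) blast
  show "span3 A B C = span3 A C B" unfolding span3_def by (subst 2) blast
qed

lemma frame_pos:
  assumes "frame n V E k B" "E \<noteq> 0\<^sub>m n n"
  shows "k \<ge> 1"
proof (rule ccontr)
  assume "\<not> k \<ge> 1"
  hence "k = 0" by simp
  hence "B * transpose_mat B = 0\<^sub>m n n"
    using assms(1) by (intro eq_matI) (auto simp: frame_def scalar_prod_def)
  thus False using assms by (simp add: frame_def)
qed

text \<open>The trace of \<open>U V = E1 V + E2 V + E3 V\<close> shows that the three orthonormal bases have \<open>n\<close> vectors
  together.\<close>

lemma orthogonal_idempotents_congruent:
  assumes V: "V \<in> carrier_mat n n" "transpose_mat V = V" and UV: "U * V = 1\<^sub>m n"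
    and E1: "E1 \<in> carrier_mat n n" "transpose_mat E1 = E1" "E1 * (V * E1) = E1" "E1 \<noteq> 0\<^sub>m n n"
    and E2: "E2 \<in> carrier_mat n n" "transpose_mat E2 = E2" "E2 * (V * E2) = E2" "E2 \<noteq> 0\<^sub>m n n"
    and E3: "E3 \<in> carrier_mat n n" "transpose_mat E3 = E3" "E3 * (V * E3) = E3" "E3 \<noteq> 0\<^sub>m n n"
    and orth: "E1 * (V * E2) = 0\<^sub>m n n" "E1 * (V * E3) = 0\<^sub>m n n" "E2 * (V * E3) = 0\<^sub>m n n"
    and U: "U = E1 + E2 + E3"
  shows "\<exists>k1 k2 k3. k1 \<ge> k2 \<and> k2 \<ge> k3 \<and> k3 \<ge> 1 \<and> k1 + k2 + k3 = n \<and>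
    congruent_mats n (span3 E1 E2 E3) (diag_net k1 k2 k3)"
proof -
  obtain k1 B1 where B1: "frame n V E1 k1 B1" using idempotent_frame[OF V E1(1-3)] by blast
  obtain k2 B2 where B2: "frame n V E2 k2 B2" using idempotent_frame[OF V E2(1-3)] by blast
  obtain k3 B3 where B3: "frame n V E3 k3 B3" using idempotent_frame[OF V E3(1-3)] by blast
  have orth': "E2 * (V * E1) = 0\<^sub>m n n" "E3 * (V * E1) = 0\<^sub>m n n" "E3 * (V * E2) = 0\<^sub>m n n"
    using orthogonal_sym[OF V E1(1,2) E2(1,2) orth(1)] orthogonal_sym[OF V E1(1,2) E3(1,2) orth(2)]
      orthogonal_sym[OF V E2(1,2) E3(1,2) orth(3)] by auto
  have pos: "k1 \<ge> 1" "k2 \<ge> 1" "k3 \<ge> 1"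
    using frame_pos B1 B2 B3 E1(4) E2(4) E3(4) by blast+
  have "U * V = E1 * V + E2 * V + E3 * V"
    unfolding U by (simp only: add_mult_distrib_mat[OF add_carrier_mat[OF E2(1)] E3(1) V(1)]
        add_mult_distrib_mat[OF E1(1) E2(1) V(1)])
  hence "(\<Sum>i<n. (U * V) $$ (i, i)) = (\<Sum>i<n. (E1 * V) $$ (i, i)) + (\<Sum>i<n. (E2 * V) $$ (i, i))
     + (\<Sum>i<n. (E3 * V) $$ (i, i))"
    using V E1 E2 E3 by (simp add: sum.distrib del: index_mult_mat(1))
  moreover have "(\<Sum>i<n. (U * V) $$ (i, i)) = of_nat n" by (simp add: UV)
  ultimately have "(of_nat n :: complex) = of_nat (k1 + k2 + k3)"
    using frame_facts(5)[OF V B1] frame_facts(5)[OF V B2] frame_facts(5)[OF V B3]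
    by simp
  hence n: "n = k1 + k2 + k3" using of_nat_eq_iff by blast
  note p = span3_perm[OF E1(1) E2(1) E3(1)] span3_perm(2)[OF E2(1) E1(1) E3(1)]
    span3_perm(1)[OF E1(1) E3(1) E2(1)] span3_perm(2)[OF E3(1) E1(1) E2(1)]
  consider "k1 \<ge> k2 \<and> k2 \<ge> k3" | "k1 \<ge> k3 \<and> k3 \<ge> k2" | "k2 \<ge> k1 \<and> k1 \<ge> k3"
    | "k2 \<ge> k3 \<and> k3 \<ge> k1" | "k3 \<ge> k1 \<and> k1 \<ge> k2" | "k3 \<ge> k2 \<and> k2 \<ge> k1"
    by linarith
  thus ?thesis
  proof cases
    case 1
    thus ?thesis using congruent_diag_net[OF V B1 B2 B3 orth n] pos n by metis
  next
    case 2
    have "congruent_mats n (span3 E1 E3 E2) (diag_net k1 k3 k2)"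
      using congruent_diag_net[OF V B1 B3 B2 orth(2,1) orth'(3)] n by simp
    thus ?thesis using 2 pos n p by (metis add.commute add.assoc)
  next
    case 3
    have "congruent_mats n (span3 E2 E1 E3) (diag_net k2 k1 k3)"
      using congruent_diag_net[OF V B2 B1 B3 orth'(1) orth(3,2)] n by simp
    thus ?thesis using 3 pos n p by (metis add.commute add.assoc)
  next
    case 4
    have "congruent_mats n (span3 E2 E3 E1) (diag_net k2 k3 k1)"
      using congruent_diag_net[OF V B2 B3 B1 orth(3) orth'(1,2)] n by simp
    thus ?thesis using 4 pos n p by (metis add.commute add.assoc)
  next
    case 5
    have "congruent_mats n (span3 E3 E1 E2) (diag_net k3 k1 k2)"
      using congruent_diag_net[OF V B3 B1 B2 orth'(2,3) orth(1)] n by simp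
    thus ?thesis using 5 pos n p by (metis add.commute add.assoc)
  next
    case 6
    have "congruent_mats n (span3 E3 E2 E1) (diag_net k3 k2 k1)"
      using congruent_diag_net[OF V B3 B2 B1 orth'(3,2,1)] n by simp
    moreover have "span3 E1 E2 E3 = span3 E3 E2 E1" using p by simp
    ultimately have "k3 \<ge> k2 \<and> k2 \<ge> k1 \<and> k1 \<ge> 1 \<and> k3 + k2 + k1 = n \<and>
       congruent_mats n (span3 E1 E2 E3) (diag_net k3 k2 k1)" using 6 pos n by simp
    thus ?thesis by blast
  qed
qed

section \<open>The Jordan product in terms of the inverse of the unit\<close>

text \<open>The inverse inherits symmetry from \<open>U\<close>, since the transpose of a right inverse of a symmetric matrix
  is a left inverse.\<close>

lemma jordan_unit_inverse:
  assumes net: "jordan_net_wrt n L U"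
  obtains V where "V \<in> carrier_mat n n" "transpose_mat V = V" "U * V = 1\<^sub>m n" "V * U = 1\<^sub>m n"
    "\<And>X Y. jordan_prod U X Y = (1/2) \<cdot>\<^sub>m (X * V * Y + Y * V * X)"
proof -
  have U: "U \<in> carrier_mat n n" "transpose_mat U = U" and inv: "invertible_mat U"
    using net by (auto simp: jordan_net_wrt_def sym_mats_def)
  obtain W where W: "inverts_mat U W" "inverts_mat W U"
    using inv by (auto simp: invertible_mat_def)
  have "dim_row W = n" "dim_col W = n"
    using W U unfolding inverts_mat_def
    by (metis carrier_matD index_mult_mat(2,3) index_one_mat(2,3))+
  hence Wc: "W \<in> carrier_mat n n" by auto
  have UW: "U * W = 1\<^sub>m n" "W * U = 1\<^sub>m n" using W U Wc by (auto simp: inverts_mat_def)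
  have "U \<in> Units (ring_mat TYPE(complex) n ())"
    using U Wc UW by (auto simp: Units_def ring_mat_def)
  then obtain V where V: "mat_inverse U = Some V"
    using mat_inverse(1)[OF U(1), of "()"] by (cases "mat_inverse U") auto
  have V': "U * V = 1\<^sub>m n" "V * U = 1\<^sub>m n" "V \<in> carrier_mat n n"
    using mat_inverse(2)[OF U(1) V] by auto
  note [simp] = carrier_matD[OF U(1)] carrier_matD[OF V'(3)]
  have "transpose_mat V * U = 1\<^sub>m n"
    using transpose_mult[OF U(1) V'(3)] V'(1) U(2) by simp
  hence "transpose_mat V * (U * V) = V"
    using V'(3) by (simp flip: mult_mat_assoc_dim)
  hence "transpose_mat V = V" using V' by simp
  thus ?thesis using that[OF V'(3) _ V'(1,2)] by (simp add: jordan_prod_def V Let_def)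
qed

lemma half_double_mat: "(1/2) \<cdot>\<^sub>m (A + A) = (A :: complex mat)"
  by (rule eq_matI) auto

lemma half_mat_eq_0:
  assumes "(1/2) \<cdot>\<^sub>m A = 0\<^sub>m n n"
  shows "A = (0\<^sub>m n n :: complex mat)"
proof (rule eq_matI)
  have d: "dim_row A = n" "dim_col A = n" using arg_cong[OF assms, of dim_row] arg_cong[OF assms, of dim_col] by auto
  thus "dim_row A = dim_row (0\<^sub>m n n :: complex mat)" "dim_col A = dim_col (0\<^sub>m n n :: complex mat)" by auto
  fix i j assume "i < dim_row (0\<^sub>m n n :: complex mat)" "j < dim_col (0\<^sub>m n n :: complex mat)"
  thus "A $$ (i, j) = 0\<^sub>m n n $$ (i, j)" using arg_cong[OF assms, of "\<lambda>M. M $$ (i, j)"] d by simp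
qed

section \<open>Nets spanned by idempotents\<close>

text \<open>The Peirce-type argument: with \<open>e = X V\<close> and \<open>f = Y V\<close>, multiplying \<open>e f + f e = 0\<close> by the
  idempotent \<open>e\<close> from either side gives \<open>e f = - e f e = f e\<close>, and hence \<open>2 e f = 0\<close>.\<close>

lemma orthogonal_if_anticommutes_with_idempotent:
  fixes V X Y :: "complex mat"
  assumes V: "V \<in> carrier_mat n n" and X: "X \<in> carrier_mat n n" "X * (V * X) = X"
    and Y: "Y \<in> carrier_mat n n" 
    and XY: "X * (V * Y) + Y * (V * X) = 0\<^sub>m n n"
  shows "X * (V * Y) = 0\<^sub>m n n"
proof -
  define S where "S = X * (V * Y)"
  define T where "T = Y * (V * X)"
  define W where "W = X * (V * T)"
  note [simp] = carrier_matD[OF V] carrier_matD[OF X(1)] carrier_matD[OF Y]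
  have car: "S \<in> carrier_mat n n" "T \<in> carrier_mat n n" "W \<in> carrier_mat n n"
    using V X(1) Y by (auto simp: S_def T_def W_def)
  have ST: "S + T = 0\<^sub>m n n" using XY by (simp add: S_def T_def)
  have VS: "V * S \<in> carrier_mat n n" "V * T \<in> carrier_mat n n" "V * X \<in> carrier_mat n n"
    using V X(1) car by auto
  have XS: "X * (V * S) = S" using mult_mat_absorb[OF X(2), of "V * Y"] by (simp add: S_def)
  have SX: "S * (V * X) = W"
    by (simp add: S_def W_def T_def mult_mat_assoc_dim)
  have TX: "T * (V * X) = T"
    by (simp add: T_def mult_mat_assoc_dim X(2))
  have "X * (V * (S + T)) = S + W"
    by (simp only: mult_add_distrib_mat[OF V car(1,2)] mult_add_distrib_mat[OF X(1) VS(1,2)] XS W_def)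
  hence SW: "S + W = 0\<^sub>m n n" using V X(1) by (simp add: ST)
  have "(S + T) * (V * X) = W + T"
    by (simp only: add_mult_distrib_mat[OF car(1,2) VS(3)] SX TX)
  hence WT: "W + T = 0\<^sub>m n n" using VS by (simp add: ST)
  have "S $$ (i, j) = 0" if "i < n" "j < n" for i j
  proof -
    have "S $$ (i, j) + T $$ (i, j) = 0" "S $$ (i, j) + W $$ (i, j) = 0" "W $$ (i, j) + T $$ (i, j) = 0"
      using arg_cong[OF ST, of "\<lambda>M. M $$ (i, j)"] arg_cong[OF SW, of "\<lambda>M. M $$ (i, j)"]
        arg_cong[OF WT, of "\<lambda>M. M $$ (i, j)"] that car by auto
    moreover have "2 * S $$ (i, j) =
        (S $$ (i, j) + T $$ (i, j)) + (S $$ (i, j) + W $$ (i, j)) - (W $$ (i, j) + T $$ (i, j))"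
      by simp
    ultimately have "2 * S $$ (i, j) = 0" by simp
    thus ?thesis by simp
  qed
  hence "S = 0\<^sub>m n n" using car by (intro eq_matI) auto
  thus ?thesis by (simp add: S_def)
qed

lemma jordan_product_nested:
  fixes V X Y :: "complex mat"
  assumes "V \<in> carrier_mat n n" "X \<in> carrier_mat n n" "Y \<in> carrier_mat n n"
  shows "(1/2) \<cdot>\<^sub>m (X * V * X + X * V * X) = X * (V * X)"
    "(1/2) \<cdot>\<^sub>m (X * V * Y + Y * V * X) = 0\<^sub>m n n \<Longrightarrow> X * (V * Y) + Y * (V * X) = 0\<^sub>m n n"
  using assms by (auto simp: half_double_mat dest!: half_mat_eq_0)

text \<open>The complement \<open>Z = U - X - Y\<close> of the two given idempotents is the third one, and exchanging \<open>U\<close> for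
  \<open>Z\<close> does not change the span.\<close>

lemma type_1a_congruent:
  assumes "jordan_net_type_1a n L"
  shows "\<exists>k1 k2 k3. k1 \<ge> k2 \<and> k2 \<ge> k3 \<and> k3 \<ge> 1 \<and> k1 + k2 + k3 = n \<and>
    congruent_mats n L (diag_net k1 k2 k3)"
proof -
  obtain U X Y where net: "jordan_net_wrt n L U"
    and bas: "vectorspace.basis class_ring (mat_space_on n L) {U, X, Y}"
    and pr: "jordan_prod U X X = X" "jordan_prod U Y Y = Y" "jordan_prod U X Y = 0\<^sub>m n n"
    using assms unfolding jordan_net_type_1a_def by blast
  obtain V where V: "V \<in> carrier_mat n n" "transpose_mat V = V" "U * V = 1\<^sub>m n" "V * U = 1\<^sub>m n"
    "\<And>X Y. jordan_prod U X Y = (1/2) \<cdot>\<^sub>m (X * V * Y + Y * V * X)"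
    using jordan_unit_inverse[OF net] by blast
  have sub: "mat_subspace n L" and dim: "vectorspace.dim class_ring (mat_space_on n L) = 3"
    and LS: "L \<subseteq> sym_mats n"
    using net by (auto simp: jordan_net_wrt_def)
  note sp = span_basis3[OF sub dim bas]
  have Us: "U \<in> carrier_mat n n" "transpose_mat U = U" and Xs: "X \<in> carrier_mat n n" "transpose_mat X = X"
    and Ys: "Y \<in> carrier_mat n n" "transpose_mat Y = Y"
    using sp(3) LS by (auto simp: sym_mats_def)
  have XX: "X * (V * X) = X" and YY: "Y * (V * Y) = Y"
    using pr(1,2) unfolding V(5) jordan_product_nested(1)[OF V(1) Xs(1) Xs(1)]
      jordan_product_nested(1)[OF V(1) Ys(1) Ys(1)] .
  have anti: "X * (V * Y) + Y * (V * X) = 0\<^sub>m n n"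
    using jordan_product_nested(2)[OF V(1) Xs(1) Ys(1)] pr(3) unfolding V(5) .
  have XY: "X * (V * Y) = 0\<^sub>m n n"
    by (rule orthogonal_if_anticommutes_with_idempotent[OF V(1) Xs(1) XX Ys(1) anti])
  have YX: "Y * (V * X) = 0\<^sub>m n n"
    by (rule orthogonal_sym[OF V(1,2) Xs Ys XY])
  define Z where "Z = U - X - Y"
  have UX: "U - X \<in> carrier_mat n n" by (rule minus_carrier_mat[OF Xs(1)])
  have Z: "Z \<in> carrier_mat n n" unfolding Z_def by (rule minus_carrier_mat[OF Ys(1)])
  have Zt: "transpose_mat Z = Z"
    unfolding Z_def by (simp only: transpose_minus[OF UX Ys(1)] transpose_minus[OF Us(1) Xs(1)] Us Xs Ys)
  have c: "V * U \<in> carrier_mat n n" "V * X \<in> carrier_mat n n" "V * Y \<in> carrier_mat n n"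
     "V * U - V * X \<in> carrier_mat n n" "V * Z \<in> carrier_mat n n"
    using V(1) Us(1) Xs(1) Ys(1) Z by (auto intro!: minus_carrier_mat)
  have VZ: "V * Z = V * U - V * X - V * Y"
    unfolding Z_def by (simp only: mult_minus_distrib_mat[OF V(1) UX Ys(1)] mult_minus_distrib_mat[OF V(1) Us(1) Xs(1)])
  have MVZ: "M * (V * Z) = M - M * (V * X) - M * (V * Y)" if "M \<in> carrier_mat n n" for M
  proof -
    have "M * (V * Z) = M * (V * U) - M * (V * X) - M * (V * Y)"
      by (simp only: VZ mult_minus_distrib_mat[OF that c(4,3)] mult_minus_distrib_mat[OF that c(1,2)])
    thus ?thesis using that by (simp add: V(4))
  qed
  have XZ: "X * (V * Z) = 0\<^sub>m n n" using Xs(1) by (simp add: MVZ XX XY)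
  have YZ: "Y * (V * Z) = 0\<^sub>m n n" using Ys(1) by (auto simp: MVZ YY YX)
  have ZZ: "Z * (V * Z) = Z"
  proof -
    have "Z * (V * Z) = U * (V * Z) - X * (V * Z) - Y * (V * Z)"
      by (subst (1) Z_def) (simp only: minus_mult_distrib_mat[OF UX Ys(1) c(5)] minus_mult_distrib_mat[OF Us(1) Xs(1) c(5)])
    also have "U * (V * Z) = U * V * Z" using V(1) Us(1) Z by simp
    finally show ?thesis using Z by (auto simp: V(3) XZ YZ)
  qed
  have nz: "X \<noteq> 0\<^sub>m n n" "Y \<noteq> 0\<^sub>m n n" "Z \<noteq> 0\<^sub>m n n"
  proof -
    show "X \<noteq> 0\<^sub>m n n"
    proof
      assume "X = 0\<^sub>m n n"
      hence "0 \<cdot>\<^sub>m U + 1 \<cdot>\<^sub>m X + 0 \<cdot>\<^sub>m Y = 0\<^sub>m n n" using Us Ys by (intro eq_matI) auto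
      from sp(2)[OF this] show False by simp
    qed
    show "Y \<noteq> 0\<^sub>m n n"
    proof
      assume "Y = 0\<^sub>m n n"
      hence "0 \<cdot>\<^sub>m U + 0 \<cdot>\<^sub>m X + 1 \<cdot>\<^sub>m Y = 0\<^sub>m n n" using Us Xs by (intro eq_matI) auto
      from sp(2)[OF this] show False by simp
    qed
    show "Z \<noteq> 0\<^sub>m n n"
    proof
      assume "Z = 0\<^sub>m n n"
      moreover have "1 \<cdot>\<^sub>m U + (-1) \<cdot>\<^sub>m X + (-1) \<cdot>\<^sub>m Y = Z"
        using Us Xs Ys by (intro eq_matI) (auto simp: Z_def)
      ultimately have "1 \<cdot>\<^sub>m U + (-1) \<cdot>\<^sub>m X + (-1) \<cdot>\<^sub>m Y = 0\<^sub>m n n" by simp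
      from sp(2)[OF this] show False by simp
    qed
  qed
  have "L = span3 X Y Z"
  proof -
    have 1: "a \<cdot>\<^sub>m U + b \<cdot>\<^sub>m X + c \<cdot>\<^sub>m Y = (a + b) \<cdot>\<^sub>m X + (a + c) \<cdot>\<^sub>m Y + a \<cdot>\<^sub>m Z" for a b c
      using Us Xs Ys by (intro eq_matI) (auto simp: Z_def algebra_simps)
    have 2: "a \<cdot>\<^sub>m X + b \<cdot>\<^sub>m Y + c \<cdot>\<^sub>m Z = c \<cdot>\<^sub>m U + (a - c) \<cdot>\<^sub>m X + (b - c) \<cdot>\<^sub>m Y" for a b c
      using Us Xs Ys by (intro eq_matI) (auto simp: Z_def algebra_simps)
    show ?thesis
    proof (intro equalityI subsetI)
      fix M assume "M \<in> L"
      then obtain a b c where "M = a \<cdot>\<^sub>m U + b \<cdot>\<^sub>m X + c \<cdot>\<^sub>m Y" using sp(1) unfolding span3_def by blast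
      thus "M \<in> span3 X Y Z" unfolding span3_def 1 by blast
    next
      fix M assume "M \<in> span3 X Y Z"
      then obtain a b c where "M = a \<cdot>\<^sub>m X + b \<cdot>\<^sub>m Y + c \<cdot>\<^sub>m Z" unfolding span3_def by blast
      thus "M \<in> L" unfolding 2 by (subst sp(1)) (auto simp: span3_def)
    qed
  qed
  moreover have "U = X + Y + Z"
    using Us Xs Ys by (intro eq_matI) (auto simp: Z_def)
  ultimately show ?thesis
    using orthogonal_idempotents_congruent[OF V(1-3) Xs XX nz(1) Ys YY nz(2) Z Zt ZZ nz(3) XY XZ YZ]
    by simp
qed

section \<open>Anticommuting involutions and Kronecker products\<close>

text \<open>The three matrices are the block sums of \<open>k\<close> copies of \<open>Diag(1,1)\<close>, \<open>Diag(1,-1)\<close> and the swap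
  matrix; the coefficients of a symmetric \<open>A\<close> are half the sum and half the difference of its diagonal
  entries, and its off-diagonal entry.\<close>

lemma interlaced_span_eq:
  fixes k :: nat
  defines "DU \<equiv> mat (2 * k) (2 * k) (\<lambda>(l, j). if l = j then 1 else (0 :: complex))"
    and "DX \<equiv> mat (2 * k) (2 * k) (\<lambda>(l, j). if l = j then (if even j then 1 else - 1) else (0 :: complex))"
    and "DY \<equiv> mat (2 * k) (2 * k) (\<lambda>(l, j). if l = (if even j then j + 1 else j - 1) then 1 else (0 :: complex))"
  shows "span3 DU DX DY = {kronecker_prod (1\<^sub>m k) A | A. A \<in> sym_mats 2}"
proof -
  have comb: "a \<cdot>\<^sub>m DU + b \<cdot>\<^sub>m DX + c \<cdot>\<^sub>m DY = kronecker_prod (1\<^sub>m k) A"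
    if A: "A \<in> carrier_mat 2 2" "A $$ (0, 0) = a + b" "A $$ (1, 1) = a - b"
      "A $$ (0, 1) = c" "A $$ (1, 0) = c" for a b c A
  proof (rule eq_matI)
    fix i j assume "i < dim_row (kronecker_prod (1\<^sub>m k) A)" "j < dim_col (kronecker_prod (1\<^sub>m k) A)"
    hence ij: "i < 2 * k" "j < 2 * k" using A(1) by (auto simp: kronecker_prod_def)
    have dm: "i div 2 < k" "j div 2 < k" using ij by auto
    have "kronecker_prod (1\<^sub>m k) A $$ (i, j) =
        (if i div 2 = j div 2 then A $$ (i mod 2, j mod 2) else 0)"
      using ij A(1) dm by (simp add: kronecker_prod_def mult.commute)
    also have "\<dots> = (a \<cdot>\<^sub>m DU + b \<cdot>\<^sub>m DX + c \<cdot>\<^sub>m DY) $$ (i, j)"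
    proof -
      obtain i' r where i: "i = 2 * i' + r" "r < 2" by (metis mod_less_divisor mult_div_mod_eq zero_less_numeral)
      obtain j' t where j: "j = 2 * j' + t" "t < 2" by (metis mod_less_divisor mult_div_mod_eq zero_less_numeral)
      have "r = 0 \<or> r = 1" "t = 0 \<or> t = 1" using i j by auto
      thus ?thesis using ij i j A by (auto simp: DU_def DX_def DY_def) presburger+
    qed
    finally show "(a \<cdot>\<^sub>m DU + b \<cdot>\<^sub>m DX + c \<cdot>\<^sub>m DY) $$ (i, j) = kronecker_prod (1\<^sub>m k) A $$ (i, j)" by simp
  qed (use A(1) in \<open>auto simp: DU_def DX_def DY_def kronecker_prod_def\<close>)
  show ?thesis
  proof (intro equalityI subsetI)
    fix M assume "M \<in> span3 DU DX DY"
    then obtain a b c where M: "M = a \<cdot>\<^sub>m DU + b \<cdot>\<^sub>m DX + c \<cdot>\<^sub>m DY" unfolding span3_def by blast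
    define A where "A = mat 2 2 (\<lambda>(i, j). if i = j then (if i = 0 then a + b else a - b) else c)"
    have "A \<in> sym_mats 2" by (auto simp: sym_mats_def A_def intro!: eq_matI)
    moreover have "M = kronecker_prod (1\<^sub>m k) A" unfolding M by (rule comb) (auto simp: A_def)
    ultimately show "M \<in> {kronecker_prod (1\<^sub>m k) A | A. A \<in> sym_mats 2}" by blast
  next
    fix M assume "M \<in> {kronecker_prod (1\<^sub>m k) A | A. A \<in> sym_mats 2}"
    then obtain A where M: "M = kronecker_prod (1\<^sub>m k) A" and A: "A \<in> carrier_mat 2 2" "transpose_mat A = A"
      by (auto simp: sym_mats_def)
    have s: "A $$ (1, 0) = A $$ (0, 1)"
      using A by (metis carrier_matD index_transpose_mat(1) one_less_numeral_iff pos2 semiring_norm(76))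
    have "M = ((A $$ (0, 0) + A $$ (1, 1)) / 2) \<cdot>\<^sub>m DU + ((A $$ (0, 0) - A $$ (1, 1)) / 2) \<cdot>\<^sub>m DX
        + A $$ (0, 1) \<cdot>\<^sub>m DY"
      unfolding M by (rule comb[symmetric]) (use A(1) s in \<open>auto simp: field_simps\<close>)
    thus "M \<in> span3 DU DX DY" unfolding span3_def by blast
  qed
qed

text \<open>\<open>X V\<close> acts as \<open>1\<close> on the image of \<open>E V\<close> and as \<open>-1\<close> on that of \<open>F V\<close>, and \<open>Y V\<close> exchanges them by
  anticommutation. As \<open>Y V\<close> preserves the form \<open>V\<close>, it carries the orthonormal basis \<open>B\<close> to an
  orthonormal basis \<open>C\<close> of the other image.\<close>

lemma involutions_congruent:
  assumes V: "V \<in> carrier_mat n n" "transpose_mat V = V" and UV: "U * V = 1\<^sub>m n" "V * U = 1\<^sub>m n"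
    and U: "U \<in> carrier_mat n n" "transpose_mat U = U"
    and X: "X \<in> carrier_mat n n" "transpose_mat X = X" "X * (V * X) = U"
    and Y: "Y \<in> carrier_mat n n" "transpose_mat Y = Y" "Y * (V * Y) = U"
    and anti: "X * (V * Y) + Y * (V * X) = 0\<^sub>m n n"
  shows "even n \<and>
    congruent_mats n (span3 U X Y) {kronecker_prod (1\<^sub>m (n div 2)) A | A. A \<in> sym_mats 2}"
proof -
  note [simp] = carrier_matD[OF V(1)] carrier_matD[OF U(1)] carrier_matD[OF X(1)] carrier_matD[OF Y(1)]
  have UVZ: "U * (V * Z) = Z" "V * (U * Z) = Z" if "Z \<in> carrier_mat n m" for Z m
    using that V(1) U(1) UV by (simp_all flip: mult_mat_assoc_dim)
  note c = mult_carrier_mat[OF V(1) U(1)] mult_carrier_mat[OF V(1) X(1)] mult_carrier_mat[OF V(1) Y(1)]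
  have YX: "Y * (V * X) = - (X * (V * Y))"
  proof (rule eq_matI)
    fix i j assume "i < dim_row (- (X * (V * Y)))" "j < dim_col (- (X * (V * Y)))"
    hence "i < n" "j < n" by auto
    thus "(Y * (V * X)) $$ (i, j) = (- (X * (V * Y))) $$ (i, j)"
      using arg_cong[OF anti, of "\<lambda>M. M $$ (i, j)"] by (simp add: add_eq_0_iff del: index_mult_mat(1))
  qed auto
  define E where "E = (1/2) \<cdot>\<^sub>m (U + X)"
  define F where "F = (1/2) \<cdot>\<^sub>m (U - X)"
  have UX: "U + X \<in> carrier_mat n n" "U - X \<in> carrier_mat n n"
    using U X by (auto intro: minus_carrier_mat)
  have transpose_smult: "transpose_mat (c \<cdot>\<^sub>m M) = c \<cdot>\<^sub>m transpose_mat M" for c and M :: "complex mat"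
    by (rule eq_matI) auto
  have E: "E \<in> carrier_mat n n" "transpose_mat E = E" and F: "F \<in> carrier_mat n n" "transpose_mat F = F"
    using U X UX by (auto simp: E_def F_def transpose_add[of _ n n] transpose_minus[of _ n n] transpose_smult)
  have XE: "X * (V * E) = E"
  proof -
    have "X * (V * (U + X)) = X + U"
      by (simp only: mult_add_distrib_mat[OF V(1) U(1) X(1)] UV mult_add_distrib_mat[OF X(1) one_carrier_mat c(2)] X(3) right_mult_one_mat[OF X(1)])
    also have "\<dots> = U + X" using U X by (intro comm_add_mat)
    finally show ?thesis using V X UX unfolding E_def
      by (simp add: mult_smult_distrib[of _ n n _ n])
  qed
  have EVE: "E * (V * E) = E"
  proof -
    have VE: "V * E \<in> carrier_mat n n" using V E by simp
    have "(U + X) * (V * E) = E + E"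
      by (simp only: add_mult_distrib_mat[OF U(1) X(1) VE] XE UVZ[OF E(1)])
    moreover have "E * (V * E) = (1/2) \<cdot>\<^sub>m ((U + X) * (V * E))"
      by (subst (1) E_def) (rule mult_smult_assoc_mat[OF UX(1) VE])
    ultimately show ?thesis by (simp add: half_double_mat)
  qed
  have FVE: "F * (V * E) = 0\<^sub>m n n"
  proof -
    have VE: "V * E \<in> carrier_mat n n" using V E by simp
    have "(U - X) * (V * E) = E - E"
      by (simp only: minus_mult_distrib_mat[OF U(1) X(1) VE] XE UVZ[OF E(1)])
    moreover have "F * (V * E) = (1/2) \<cdot>\<^sub>m ((U - X) * (V * E))"
      by (subst (1) F_def) (rule mult_smult_assoc_mat[OF UX(2) VE])
    ultimately show ?thesis using E by auto
  qed
  have EVF: "E * (V * F) = 0\<^sub>m n n" by (rule orthogonal_sym[OF V F E FVE])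
  obtain k B where B: "frame n V E k B" using idempotent_frame[OF V E EVE] by blast
  note fB = frame_facts[OF V B]
  have Bc: "B \<in> carrier_mat n k" "transpose_mat B * (V * B) = 1\<^sub>m k" "B * transpose_mat B = E"
    using B by (auto simp: frame_def)
  define C where "C = Y * (V * B)"
  have Cc: "C \<in> carrier_mat n k" using Y V Bc by (simp add: C_def)
  note [simp] = carrier_matD[OF Bc(1)] carrier_matD[OF Cc] carrier_matD[OF E(1)] carrier_matD[OF F(1)]
  have Ct: "transpose_mat C = transpose_mat B * (V * Y)"
    unfolding C_def transpose_mult[OF Y(1) mult_carrier_mat[OF V(1) Bc(1)]] transpose_mult[OF V(1) Bc(1)] V(2) Y(2)
    by (simp add: mult_mat_assoc_dim)
  have YVC: "Y * (V * C) = B"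
    unfolding C_def using Bc(1) by (simp add: mult_mat_absorb[OF Y(3)] UVZ)
  have Cgram: "transpose_mat C * (V * C) = 1\<^sub>m k"
    using Bc(2) by (simp add: Ct mult_mat_assoc_dim YVC)
  have YEY: "Y * (V * (E * (V * Y))) = F"
  proof -
    have a: "E * (V * Y) = (1/2) \<cdot>\<^sub>m (Y + X * (V * Y))"
      unfolding E_def by (simp only: mult_smult_assoc_mat[OF UX(1) c(3)] add_mult_distrib_mat[OF U(1) X(1) c(3)] UVZ[OF Y(1)])
    have m: "X * (V * Y) \<in> carrier_mat n n" "V * (X * (V * Y)) \<in> carrier_mat n n" using X V Y by simp_all
    have m': "Y + X * (V * Y) \<in> carrier_mat n n" "V * (Y + X * (V * Y)) \<in> carrier_mat n n"
      using m V(1) by simp_all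
    have "Y * (V * (X * (V * Y))) = - (X * (V * Y)) * (V * Y)"
      by (rule mult_mat_absorb[OF YX]) auto
    also have "\<dots> = - X"
      using X Y by (simp add: mult_mat_assoc_dim Y(3) UV flip: uminus_mult_left_mat)
    finally have b: "Y * (V * (X * (V * Y))) = - X" .
    have "Y * (V * (Y + X * (V * Y))) = U + - X"
      by (simp only: mult_add_distrib_mat[OF V(1) Y(1) m(1)] mult_add_distrib_mat[OF Y(1) c(3) m(2)] b Y(3))
    also have "\<dots> = U - X" using U X by (auto intro!: eq_matI)
    finally have "Y * (V * (Y + X * (V * Y))) = U - X" .
    thus ?thesis
      by (simp only: a F_def mult_smult_distrib[OF V(1) m'(1)] mult_smult_distrib[OF Y(1) m'(2)])
  qed
  have CC: "C * transpose_mat C = F"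
  proof -
    have "C * transpose_mat C = Y * (V * (E * (V * Y)))"
      unfolding Ct by (simp add: C_def mult_mat_assoc_dim flip: Bc(3))
    thus ?thesis using YEY by simp
  qed
  have C: "frame n V F k C" using Cc Cgram CC by (simp add: frame_def)
  note fC = frame_facts[OF V C]
  have sumEF: "U = E + F" "X = E - F"
  proof -
    show "U = E + F" by (rule eq_matI) (use U(1) X(1) in \<open>simp_all add: E_def F_def field_simps\<close>)
    show "X = E - F" by (rule eq_matI) (use U(1) X(1) in \<open>simp_all add: E_def F_def field_simps\<close>)
  qed
  have "U * V = E * V + F * V"
    by (subst sumEF(1)) (rule add_mult_distrib_mat[OF E(1) F(1) V(1)])
  hence "(\<Sum>i<n. (U * V) $$ (i, i)) = (\<Sum>i<n. (E * V) $$ (i, i)) + (\<Sum>i<n. (F * V) $$ (i, i))"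
    by (simp add: sum.distrib del: index_mult_mat(1))
  moreover have "(\<Sum>i<n. (U * V) $$ (i, i)) = of_nat n" by (simp add: UV)
  ultimately have "(of_nat n :: complex) = of_nat (2 * k)"
    using fB(5) fC(5) by simp
  hence n: "n = 2 * k" using of_nat_eq_iff by blast
  have VBC: "V * B \<in> carrier_mat n k" "V * C \<in> carrier_mat n k" using V Bc Cc by simp_all
  have XB: "X * (V * B) = B"
  proof -
    have "X * (V * B) = E * (V * B) - F * (V * B)"
      by (subst sumEF(2)) (rule minus_mult_distrib_mat[OF E(1) F(1) VBC(1)])
    also have "\<dots> = B - 0\<^sub>m n k" by (simp only: fB(3) frame_act_0[OF V B F(1) FVE])
    also have "\<dots> = B" by (rule eq_matI) (simp_all add: Bc(1))
    finally show ?thesis .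
  qed
  have XC: "X * (V * C) = - C"
  proof -
    have "X * (V * C) = E * (V * C) - F * (V * C)"
      by (subst sumEF(2)) (rule minus_mult_distrib_mat[OF E(1) F(1) VBC(2)])
    also have "\<dots> = 0\<^sub>m n k - C" by (simp only: fC(3) frame_act_0[OF V C E(1) EVF])
    also have "\<dots> = - C" by (rule eq_matI) (simp_all add: Cc)
    finally show ?thesis .
  qed
  \<comment> \<open>even and odd positions of a Kronecker product \<open>1 \<otimes> A\<close> carry the two coordinates of each block\<close>
  define q where "q = (\<lambda>j. if even j then col B (j div 2) else col C (j div 2))"
  have half: "j div 2 < k" if "j < n" for j using that n by auto
  have q: "q j \<in> carrier_vec n" for j
    by (rule carrier_vecI) (simp add: q_def)
  have gram: "q i \<bullet> (V *\<^sub>v q j) = (if i = j then 1 else 0)" if "i < n" "j < n" for i j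
  proof -
    have "i = j \<longleftrightarrow> even i = even j \<and> i div 2 = j div 2" by presburger
    thus ?thesis using half[OF that(1)] half[OF that(2)] unfolding q_def
      by (auto simp: frame_gram[OF V(1) B] frame_gram[OF V(1) C]
        frames_gram_0[OF V B C EVF] frames_gram_0[OF V C B FVE])
  qed
  obtain Q where Q: "Q \<in> carrier_mat n n" "\<And>j. j < n \<Longrightarrow> col Q j = q j"
    "transpose_mat Q * (V * Q) = 1\<^sub>m n"
    using orthonormal_columns[OF V(1) q gram] by blast
  have flip: "(if even j then j + 1 else j - 1) < n" if "j < n" for j
    using that n by (auto elim!: evenE)
  have qflip: "q (if even j then j + 1 else j - 1) = (if even j then col C (j div 2) else col B (j div 2))" for j
    by (auto simp: q_def elim!: oddE)
  have one: "1 \<cdot>\<^sub>v v = v" for v :: "complex vec" by auto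
  have colneg: "col (- C) a = (-1) \<cdot>\<^sub>v col C a" if "a < k" for a
    using that by (intro eq_vecI) auto
  define D where "D = (\<lambda>s (d :: nat \<Rightarrow> complex). mat n n (\<lambda>(l, j). if l = s j then d j else 0))"
  have D: "D s d \<in> carrier_mat n n" for s d by (simp add: D_def)
  have 1: "U * (V * Q) = Q * D (\<lambda>j. j) (\<lambda>j. 1)" unfolding D_def
  proof (rule monomial_intertwine[OF U(1) V(1) Q(1)])
    fix j assume j: "j < n"
    show "U *\<^sub>v (V *\<^sub>v col Q j) = 1 \<cdot>\<^sub>v col Q j"
      using col_of_mult_eq[OF UVZ(1)[OF Q(1)] U(1) V(1) Q(1) j] by (simp add: one)
  qed
  have 2: "X * (V * Q) = Q * D (\<lambda>j. j) (\<lambda>j. if even j then 1 else - 1)" unfolding D_def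
  proof (rule monomial_intertwine[OF X(1) V(1) Q(1)])
    fix j assume j: "j < n"
    show "X *\<^sub>v (V *\<^sub>v col Q j) = (if even j then 1 else - 1) \<cdot>\<^sub>v col Q j"
      using half[OF j] unfolding Q(2)[OF j] q_def
      by (auto simp: one colneg col_of_mult_eq[OF XB X(1) V(1) Bc(1)] col_of_mult_eq[OF XC X(1) V(1) Cc])
  qed
  have 3: "Y * (V * Q) = Q * D (\<lambda>j. if even j then j + 1 else j - 1) (\<lambda>j. 1)" unfolding D_def
  proof (rule monomial_intertwine[OF Y(1) V(1) Q(1) flip])
    fix j assume j: "j < n"
    show "Y *\<^sub>v (V *\<^sub>v col Q j) = 1 \<cdot>\<^sub>v col Q (if even j then j + 1 else j - 1)"
      using half[OF j] unfolding Q(2)[OF j] Q(2)[OF flip[OF j]] qflip one unfolding q_def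
      by (auto simp: col_of_mult_eq[OF C_def[symmetric] Y(1) V(1) Bc(1)] col_of_mult_eq[OF YVC Y(1) V(1) Cc])
  qed
  have "span3 (D (\<lambda>j. j) (\<lambda>j. 1)) (D (\<lambda>j. j) (\<lambda>j. if even j then 1 else - 1))
      (D (\<lambda>j. if even j then j + 1 else j - 1) (\<lambda>j. 1)) =
      {kronecker_prod (1\<^sub>m (n div 2)) A | A. A \<in> sym_mats 2}"
    using interlaced_span_eq[of k] unfolding D_def n by simp
  thus ?thesis
    using congruent_span3[OF V Q(1,3) U(1) X(1) Y(1) D D D 1 2 3] n by simp
qed

lemma type_1b_congruent:
  assumes "jordan_net_type_1b n L"
  shows "even n \<and> congruent_mats n L {kronecker_prod (1\<^sub>m (n div 2)) A | A. A \<in> sym_mats 2}"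
proof -
  obtain U X Y where net: "jordan_net_wrt n L U"
    and bas: "vectorspace.basis class_ring (mat_space_on n L) {U, X, Y}"
    and pr: "jordan_prod U X X = U" "jordan_prod U Y Y = U" "jordan_prod U X Y = 0\<^sub>m n n"
    using assms unfolding jordan_net_type_1b_def by blast
  obtain V where V: "V \<in> carrier_mat n n" "transpose_mat V = V" "U * V = 1\<^sub>m n" "V * U = 1\<^sub>m n"
    "\<And>X Y. jordan_prod U X Y = (1/2) \<cdot>\<^sub>m (X * V * Y + Y * V * X)"
    using jordan_unit_inverse[OF net] by blast
  have sub: "mat_subspace n L" and dim: "vectorspace.dim class_ring (mat_space_on n L) = 3"
    and LS: "L \<subseteq> sym_mats n"
    using net by (auto simp: jordan_net_wrt_def)
  note sp = span_basis3[OF sub dim bas]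
  have Us: "U \<in> carrier_mat n n" "transpose_mat U = U" and Xs: "X \<in> carrier_mat n n" "transpose_mat X = X"
    and Ys: "Y \<in> carrier_mat n n" "transpose_mat Y = Y"
    using sp(3) LS by (auto simp: sym_mats_def)
  have XX: "X * (V * X) = U" and YY: "Y * (V * Y) = U"
    using pr(1,2) unfolding V(5) jordan_product_nested(1)[OF V(1) Xs(1) Xs(1)]
      jordan_product_nested(1)[OF V(1) Ys(1) Ys(1)] .
  have anti: "X * (V * Y) + Y * (V * X) = 0\<^sub>m n n"
    using jordan_product_nested(2)[OF V(1) Xs(1) Ys(1)] pr(3) unfolding V(5) .
  show ?thesis
    using involutions_congruent[OF V(1-4) Us Xs XX Ys YY anti] sp(1) by simp
qed

theorem theorem5p3:
  fixes n :: nat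
  shows "(\<forall>L. jordan_net_type_1a n L \<longrightarrow>
            (\<exists>k1 k2 k3. k1 \<ge> k2 \<and> k2 \<ge> k3 \<and> k3 \<ge> 1 \<and> k1 + k2 + k3 = n \<and>
               congruent_mats n L (diag_net k1 k2 k3))) \<and>
         (\<forall>L. jordan_net_type_1b n L \<longrightarrow>
            even n \<and>
            congruent_mats n L {kronecker_prod (1\<^sub>m (n div 2)) A | A. A \<in> sym_mats 2})"
  by (intro conjI allI impI type_1a_congruent) (auto dest: type_1b_congruent)

end
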